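(* Let $\mathcal{H}$ be a finite-dimensional complex Hilbert space, let $H$ be a Hermitian operator (the Hamiltonian) on $\mathcal{H}$, and let $P$ be the orthogonal projection onto a subspace $\mathcal{H}_S\subseteq\mathcal{H}$ such that $[P,H]=PH-HP=0$. Let $|\phi_1\rangle,\ldots,|\phi_N\rangle\in\mathcal{H}$ be walker states, and let $|\Psi\rangle=\sum_{l=1}^{N}c_l|\phi_l\rangle$ with $c_l\in\mathbb{C}$ be a linear combination of them. Let $|\Psi_Q\rangle\in\mathcal{H}$ satisfy $\langle\Psi_Q|\Psi\rangle\neq 0$. If all walker states $|\phi_l\rangle$ lie in $\mathcal{H}_S$, then the mixed-estimator energy of $|\Psi\rangle$ computed with the trial state $|\Psi_T\rangle=|\Psi_Q\rangle$ is the same as the one computed with the trial state $|\Psi_T\rangle=P|\Psi_Q\rangle$, i.e. $E(\Psi_Q,\Psi)=E(P\Psi_Q,\Psi)$ (in particular the right-hand side is well defined).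
   Context: For a trial state $|\Psi_T\rangle$ and a state $|\Psi\rangle$ in $\mathcal{H}$ with $\langle\Psi_T|\Psi\rangle\neq 0$, the mixed-estimator energy is $$E(\Psi_T,\Psi)=\frac{\langle\Psi_T|H|\Psi\rangle}{\langle\Psi_T|\Psi\rangle}.$$ The inner product is conjugate-linear in the first argument. In quantum Monte Carlo algorithms $|\Psi\rangle$ is an approximation to the ground state of $H$ expressed as a linear combination of "walker states" $|\phi_l\rangle$, with coefficients $c_l$ of the form $w_l e^{i\theta_l}/\langle\Psi_G|\phi_l\rangle$, where $w_l$ is a weight, $\theta_l$ a phase, and $|\Psi_G\rangle$ the trial state used to generate the walkers; only the fact that $|\Psi\rangle$ is a linear combination of the $|\phi_l\rangle$ is relevant here, and $|\Psi\rangle$ is kept fixed when the trial state in $E(\Psi_T,\Psi)$ is changed. *)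

theory Defs
  imports Complex_Main
begin

text \<open>
  A complex inner product space, given by its scalar multiplication and an inner product that is
  conjugate-linear in the first and linear in the second argument. By conjugate symmetry
  \<open>cinner x x\<close> is real, so positive definiteness is stated for its real part.
\<close>

locale complex_inner_product_space = vector_space scale
  for scale :: "complex \<Rightarrow> 'a::ab_group_add \<Rightarrow> 'a" +
  fixes cinner :: "'a \<Rightarrow> 'a \<Rightarrow> complex"
  assumes cinner_commute: "cinner x y = cnj (cinner y x)"
    and cinner_add_right: "cinner x (y + z) = cinner x y + cinner x z"
    and cinner_scale_right: "cinner x (scale a y) = a * cinner x y"
    and cinner_pos: "x \<noteq> 0 \<Longrightarrow> 0 < Re (cinner x x)"

text \<open>Completeness is automatic in finite dimension, hence not assumed separately.\<close>

locale finite_dim_complex_hilbert_space = complex_inner_product_space +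
  assumes finite_dim: "\<exists>B. finite_dimensional_vector_space scale B"

definition hermitian_operator ::
    "(complex \<Rightarrow> 'a::ab_group_add \<Rightarrow> 'a) \<Rightarrow> ('a \<Rightarrow> 'a \<Rightarrow> complex) \<Rightarrow> ('a \<Rightarrow> 'a) \<Rightarrow> bool"
  where "hermitian_operator scale cinner A \<longleftrightarrow>
    Vector_Spaces.linear scale scale A \<and> (\<forall>x y. cinner (A x) y = cinner x (A y))"

definition orthogonal_complement :: "('a \<Rightarrow> 'a \<Rightarrow> complex) \<Rightarrow> 'a set \<Rightarrow> 'a set"
  where "orthogonal_complement cinner S = {x. \<forall>y\<in>S. cinner y x = 0}"

text \<open>
  The orthogonal projection onto a subspace \<open>S\<close> maps \<open>x\<close> to the \<open>S\<close>-component in its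
  decomposition into a vector of \<open>S\<close> and a vector orthogonal to \<open>S\<close>. As that decomposition is
  unique, the predicate determines \<open>P\<close>; linearity of \<open>P\<close> is a consequence.
\<close>

definition orthogonal_projection_onto ::
    "('a::ab_group_add \<Rightarrow> 'a \<Rightarrow> complex) \<Rightarrow> 'a set \<Rightarrow> ('a \<Rightarrow> 'a) \<Rightarrow> bool"
  where "orthogonal_projection_onto cinner S P \<longleftrightarrow>
    (\<forall>x. P x \<in> S \<and> x - P x \<in> orthogonal_complement cinner S)"

definition commutator :: "('a::ab_group_add \<Rightarrow> 'a) \<Rightarrow> ('a \<Rightarrow> 'a) \<Rightarrow> 'a \<Rightarrow> 'a"
  where "commutator A B = (\<lambda>x. A (B x) - B (A x))"

text \<open>
  The quotient is meaningful only if \<open>cinner \<Psi>\<^sub>T \<Psi> \<noteq> 0\<close>; otherwise it takes the value \<open>0\<close>.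
\<close>

definition mixed_energy ::
    "('a \<Rightarrow> 'a \<Rightarrow> complex) \<Rightarrow> ('a \<Rightarrow> 'a) \<Rightarrow> 'a \<Rightarrow> 'a \<Rightarrow> complex"
  where "mixed_energy cinner H \<Psi>\<^sub>T \<Psi> = cinner \<Psi>\<^sub>T (H \<Psi>) / cinner \<Psi>\<^sub>T \<Psi>"

end

theory Submission
  imports Defs
begin

text \<open>All walkers lie in the subspace \<open>S\<close>, hence so does \<Psi>. Since
  \<open>P\<close> fixes \<open>S\<close> pointwise and commutes with \<open>H\<close>, the operator
  \<open>H\<close> maps \<open>S\<close> into itself
  (\<open>commuting_projection_invariant\<close>), so \<open>H \<Psi>\<close> lies in
  \<open>S\<close> too. Paired with a vector of \<open>S\<close>, a trial state and its projection
  give the same inner product (\<open>projection_cinner_left\<close>), so numerator and denominator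
  of the mixed estimator are each unchanged.\<close>

context complex_inner_product_space
begin

text \<open>The discarded part \<open>x - P x\<close> is orthogonal to \<open>S\<close> and
  contributes nothing against \<open>y\<close>.\<close>

lemma projection_cinner_left:
  assumes "orthogonal_projection_onto cinner S P" and "y \<in> S"
  shows "cinner (P x) y = cinner x y"
proof -
  have "cinner y (x - P x) = 0"
    using assms by (auto simp: orthogonal_projection_onto_def orthogonal_complement_def)
  then have "cinner y x = cinner y (P x)"
    using cinner_add_right[of y "x - P x" "P x"] by simp
  \<comment> \<open>Orthogonality is stated with the vector of \<open>S\<close> on the left;
    conjugate symmetry swaps the arguments on both sides.\<close>
  then show ?thesis
    by (metis cinner_commute)
qed

text \<open>Here \<open>x - P x\<close> lies both in \<open>S\<close> and in its orthogonal
  complement, so it is orthogonal to itself and vanishes by positive definiteness.\<close>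

lemma projection_fixes:
  assumes P: "orthogonal_projection_onto cinner S P" and S: "subspace S" and x: "x \<in> S"
  shows "P x = x"
proof -
  have "x - P x \<in> S"
    using P S x by (simp add: orthogonal_projection_onto_def subspace_diff)
  then have "cinner (x - P x) (x - P x) = 0"
    using P by (simp add: orthogonal_projection_onto_def orthogonal_complement_def)
  then have "x - P x = 0"
    using cinner_pos[of "x - P x"] by auto
  then show ?thesis by simp
qed

text \<open>All values of \<open>P\<close> lie in \<open>S\<close>, and commutation exhibits
  \<open>H x\<close> as the value \<open>P (H x)\<close>.\<close>

lemma commuting_projection_invariant:
  assumes P: "orthogonal_projection_onto cinner S P" and S: "subspace S"
    and comm: "commutator P H = (\<lambda>x. 0)" and x: "x \<in> S"
  shows "H x \<in> S"
proof -
  have "P (H x) = H (P x)"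
    using fun_cong[OF comm, of x] by (simp add: commutator_def)
  also have "\<dots> = H x"
    using projection_fixes[OF P S x] by simp
  finally show ?thesis
    using P by (metis orthogonal_projection_onto_def)
qed

end

theorem theorem1:
  fixes scale :: "complex \<Rightarrow> 'a::ab_group_add \<Rightarrow> 'a"
    and cinner :: "'a \<Rightarrow> 'a \<Rightarrow> complex"
    and H P :: "'a \<Rightarrow> 'a"
    and S :: "'a set"
    and N :: nat
    and \<phi> :: "nat \<Rightarrow> 'a"
    and c :: "nat \<Rightarrow> complex"
    and \<Psi> \<Psi>\<^sub>Q :: 'a
  assumes "finite_dim_complex_hilbert_space scale cinner"
    and "hermitian_operator scale cinner H"
    and "module.subspace scale S"
    and "orthogonal_projection_onto cinner S P"
    and "commutator P H = (\<lambda>x. 0)"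
    and "\<Psi> = (\<Sum>l=1..N. scale (c l) (\<phi> l))"
    and "cinner \<Psi>\<^sub>Q \<Psi> \<noteq> 0"
    and "\<forall>l\<in>{1..N}. \<phi> l \<in> S"
  shows "cinner (P \<Psi>\<^sub>Q) \<Psi> \<noteq> 0 \<and>
    mixed_energy cinner H \<Psi>\<^sub>Q \<Psi> = mixed_energy cinner H (P \<Psi>\<^sub>Q) \<Psi>"
proof -
  interpret finite_dim_complex_hilbert_space scale cinner by fact
  have \<Psi>: "\<Psi> \<in> S"
    using assms(3,6,8) by (auto intro!: subspace_sum subspace_scale)
  have "H \<Psi> \<in> S"
    using commuting_projection_invariant[OF assms(4,3,5) \<Psi>] .
  \<comment> \<open>Removing \<open>P\<close> against \<Psi> also gives the nonvanishing of the new
    denominator.\<close>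
  then show ?thesis
    using assms(7) \<Psi> by (simp add: mixed_energy_def projection_cinner_left[OF assms(4)])
qed

end
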